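(* Let $\lambda>0$, $b_0>0$ and $a_0>0$. The solution of $$\partial_t u=\partial_{xx}u+\lambda\,u\ln(u^2),\qquad t>0,\ x\in\mathbb{R},$$ starting from the Gaussian $u_0(x)=b_0e^{-\frac{a_0}{2}x^2}$ is the Gaussian given by $$u(t,x)=b(t)e^{-\frac{a(t)}{2}x^2}:=e^{\psi(t)e^{2\lambda t}}e^{-\frac{a(t)}{2}x^2},$$ where $$\psi(t)=\ln b_0-\frac{a_0}{2}\,\frac{\ln\lambda-\ln\left(a_0+(\lambda-a_0)e^{-2\lambda t}\right)}{\lambda-a_0}\quad\text{if }a_0\ne\lambda,\qquad \psi(t)=\ln b_0-\frac12\left(1-e^{-2\lambda t}\right)\quad\text{if }a_0=\lambda,$$ and $$a(t)=\lambda\,\frac{a_0e^{2\lambda t}}{\lambda-a_0+a_0e^{2\lambda t}}.$$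
   Context: The nonlinearity $z\mapsto\lambda z\ln(z^2)$ is extended by the value $0$ at $z=0$. Notion of solution: let $u_0$ be continuous and bounded, with continuous and bounded derivative, and bounded and piecewise continuous second derivative. A (global) solution starting from $u_0$ is a function $u:[0,\infty)\times\mathbb{R}\to\mathbb{R}$ such that, for every $T>0$: $u$ is continuous and bounded on $[0,T]\times\mathbb{R}$; $u_t,u_x,u_{xx}$ exist and are continuous on $(0,T]\times\mathbb{R}$; $u$ satisfies the equation on $(0,T]\times\mathbb{R}$; $u(t,x)$ is uniformly bounded as $|x|\to\infty$ for $t\in[0,T]$; and $u(0,\cdot)=u_0$. For $u_0\ge0$ such a solution exists and is unique. *)

theory Defs
  imports "HOL-Analysis.Analysis"
begin

definition log_nonlinearity :: "real \<Rightarrow> real \<Rightarrow> real" where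
  "log_nonlinearity lam z = (if z = 0 then 0 else lam * z * ln (z\<^sup>2))"

(* Piecewise continuity of the second derivative: there is a locally finite set S of exceptional
   points, at which g2 has finite one-sided limits but need not be a derivative of g1; the value
   of g2 on S is irrelevant. *)
definition admissible_datum :: "(real \<Rightarrow> real) \<Rightarrow> bool" where
  "admissible_datum u0 \<longleftrightarrow>
     continuous_on UNIV u0 \<and> bounded (range u0) \<and>
     (\<exists>g1 g2 S.
        (\<forall>x. (u0 has_real_derivative g1 x) (at x)) \<and>
        continuous_on UNIV g1 \<and> bounded (range g1) \<and>
        (\<forall>r. finite (S \<inter> {-r..r})) \<and>
        (\<forall>x. x \<notin> S \<longrightarrow> (g1 has_real_derivative g2 x) (at x)) \<and>
        continuous_on (- S) g2 \<and> bounded (g2 ` (- S)) \<and>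
        (\<forall>x\<in>S. (\<exists>l. (g2 \<longlongrightarrow> l) (at_left x)) \<and> (\<exists>l. (g2 \<longlongrightarrow> l) (at_right x))))"

(* Global solutions on [0,\<infinity>) \<times> \<real>; the values u t x with t < 0 play no role.
   Since u is global, the time derivative at t = T is two-sided. *)
definition log_heat_solution :: "real \<Rightarrow> (real \<Rightarrow> real) \<Rightarrow> (real \<Rightarrow> real \<Rightarrow> real) \<Rightarrow> bool" where
  "log_heat_solution lam u0 u \<longleftrightarrow>
     admissible_datum u0 \<and>
     (\<forall>T>0.
        continuous_on ({0..T} \<times> UNIV) (\<lambda>(t, x). u t x) \<and>
        bounded ((\<lambda>(t, x). u t x) ` ({0..T} \<times> UNIV)) \<and>
        (\<exists>ut ux uxx.
           (\<forall>t\<in>{0<..T}. \<forall>x.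
              ((\<lambda>s. u s x) has_real_derivative ut t x) (at t) \<and>
              ((\<lambda>y. u t y) has_real_derivative ux t x) (at x) \<and>
              ((\<lambda>y. ux t y) has_real_derivative uxx t x) (at x)) \<and>
           continuous_on ({0<..T} \<times> UNIV) (\<lambda>(t, x). ut t x) \<and>
           continuous_on ({0<..T} \<times> UNIV) (\<lambda>(t, x). ux t x) \<and>
           continuous_on ({0<..T} \<times> UNIV) (\<lambda>(t, x). uxx t x) \<and>
           (\<forall>t\<in>{0<..T}. \<forall>x. ut t x = uxx t x + log_nonlinearity lam (u t x))) \<and>
        (\<exists>M R. \<forall>t\<in>{0..T}. \<forall>x. \<bar>x\<bar> \<ge> R \<longrightarrow> \<bar>u t x\<bar> \<le> M)) \<and>
     (\<forall>x. u 0 x = u0 x)"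

definition psi :: "real \<Rightarrow> real \<Rightarrow> real \<Rightarrow> real \<Rightarrow> real" where
  "psi lam b0 a0 t =
     (if a0 \<noteq> lam
      then ln b0 - a0 / 2 * ((ln lam - ln (a0 + (lam - a0) * exp (- 2 * lam * t))) / (lam - a0))
      else ln b0 - 1 / 2 * (1 - exp (- 2 * lam * t)))"

definition amplitude :: "real \<Rightarrow> real \<Rightarrow> real \<Rightarrow> real \<Rightarrow> real" where
  "amplitude lam b0 a0 t = exp (psi lam b0 a0 t * exp (2 * lam * t))"

definition inverse_width :: "real \<Rightarrow> real \<Rightarrow> real \<Rightarrow> real" where
  "inverse_width lam a0 t =
     lam * (a0 * exp (2 * lam * t) / (lam - a0 + a0 * exp (2 * lam * t)))"

end

theory Submission
  imports Defs
begin

text \<open>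
  The Gaussian ansatz turns the equation into ordinary differential equations for the width and
  the logarithm of the amplitude, and \<open>psi\<close> and \<open>inverse_width\<close> solve them explicitly.
  For uniqueness, the nonlinearity is not Lipschitz at \<open>0\<close>, but its slope there is \<open>-\<infinity>\<close>, so on a
  bounded range it is one-sided Lipschitz, with some constant \<open>L\<close>. Hence \<open>exp (- L * t)\<close> times the
  difference of two solutions is a subsolution of the heat equation wherever it is positive, and
  the maximum principle with the penalty \<open>e * (x\<^sup>2 + 3 * t)\<close> shows that it is nowhere positive.
\<close>

section \<open>Maximum principle and uniqueness\<close>

text \<open>A negative derivative would make \<open>f\<close> larger just before \<open>t\<close>.
  Comparison with earlier times only is essential: a space-time maximum may sit at the final
  time.\<close>

lemma left_max_deriv_nonneg:
  fixes f :: "real \<Rightarrow> real"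
  assumes "(f has_real_derivative D) (at t)" "a < t" "\<And>s. a \<le> s \<Longrightarrow> s \<le> t \<Longrightarrow> f s \<le> f t"
  shows "D \<ge> 0"
proof (rule ccontr)
  assume "\<not> D \<ge> 0"
  then obtain d where d: "d > 0" "\<And>h. h > 0 \<Longrightarrow> h < d \<Longrightarrow> f t < f (t - h)"
    using DERIV_neg_dec_left[OF assms(1)] by auto
  define h where "h = min (d / 2) (t - a)"
  have "h > 0" "h < d" "h \<le> t - a" using d(1) assms(2) by (auto simp: h_def)
  then show False using d(2)[of h] assms(3)[of "t - h"] by linarith
qed

text \<open>The first derivative vanishes at the maximum. If \<open>D\<close> were positive,
  \<open>f'\<close> would be positive just to the right of \<open>x\<close>, and the mean value
  theorem would make \<open>f\<close> increase there.\<close>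

lemma local_max_second_deriv_nonpos:
  fixes f f' :: "real \<Rightarrow> real"
  assumes f': "\<And>y. (f has_real_derivative f' y) (at y)"
    and f'': "(f' has_real_derivative D) (at x)"
    and "r > 0" and max: "\<And>y. \<bar>x - y\<bar> < r \<Longrightarrow> f y \<le> f x"
  shows "D \<le> 0"
proof (rule ccontr)
  assume "\<not> D \<le> 0"
  then obtain d where d: "d > 0" "\<And>h. h > 0 \<Longrightarrow> h < d \<Longrightarrow> f' x < f' (x + h)"
    using DERIV_pos_inc_right[OF f''] by auto
  have "f' x = 0" using DERIV_local_max[OF f' \<open>r > 0\<close>] max by blast
  define h where "h = min d r / 2"
  have h: "h > 0" "h < d" "h < r" using d(1) \<open>r > 0\<close> by (auto simp: h_def)
  obtain c where c: "x < c" "c < x + h" "f (x + h) - f x = (x + h - x) * f' c"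
    using MVT2[of x "x + h" f f'] f' h by auto
  have "f' c > 0" using d(2)[of "c - x"] c h \<open>f' x = 0\<close> by auto
  then have "f (x + h) > f x" using c(3) h by (simp add: algebra_simps)
  then show False using max[of "x + h"] h by simp
qed

text \<open>On the unbounded line a supremum need not be attained; the penalty forces a positive
  maximum into a compact rectangle. The differential inequality is needed only where
  \<open>z\<close> is positive, because a positive penalised value forces \<open>z\<close> to be
  positive.\<close>

lemma heat_maximum_principle:
  fixes z :: "real \<Rightarrow> real \<Rightarrow> real"
  assumes cont: "continuous_on ({0..T} \<times> UNIV) (\<lambda>(t, x). z t x)"
    and bdd: "\<And>t x. t \<in> {0..T} \<Longrightarrow> z t x \<le> B"
    and init: "\<And>x. z 0 x \<le> 0"
    and zt: "\<And>t x. t \<in> {0<..T} \<Longrightarrow> ((\<lambda>s. z s x) has_real_derivative zt t x) (at t)"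
    and zx: "\<And>t x. t \<in> {0<..T} \<Longrightarrow> ((\<lambda>y. z t y) has_real_derivative zx t x) (at x)"
    and zxx: "\<And>t x. t \<in> {0<..T} \<Longrightarrow> ((\<lambda>y. zx t y) has_real_derivative zxx t x) (at x)"
    and sub: "\<And>t x. t \<in> {0<..T} \<Longrightarrow> z t x > 0 \<Longrightarrow> zt t x \<le> zxx t x"
    and t: "t \<in> {0..T}"
  shows "z t x \<le> 0"
proof -
  have penalised: "z t x \<le> e * (x\<^sup>2 + 3 * t)" if "e > 0" for e
  proof (rule ccontr)
    assume pos: "\<not> z t x \<le> e * (x\<^sup>2 + 3 * t)"
    define P where "P = (\<lambda>s y. z s y - e * (y\<^sup>2 + 3 * s))"
    \<comment> \<open>The rectangle of half-width \<open>R\<close> contains the offending point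
      \<open>x\<close>. Since \<open>R \<ge> 1\<close> gives \<open>R \<le> R\<^sup>2\<close>, the
      bound on \<open>\<bar>B\<bar> / e\<close> makes the penalty at the lateral sides exceed
      \<open>B\<close>.\<close>
    define R where "R = 1 + \<bar>x\<bar> + \<bar>B\<bar> / e"
    have "\<bar>B\<bar> / e \<ge> 0" using \<open>e > 0\<close> by simp
    then have R: "R \<ge> 1" "\<bar>x\<bar> < R" "\<bar>B\<bar> / e < R" by (auto simp: R_def)
    have "R * 1 \<le> R * R" using R by (intro mult_left_mono) auto
    then have "\<bar>B\<bar> / e < R\<^sup>2" using R(3) by (simp add: power2_eq_square del: divide_less_eq)
    then have eR: "B < e * R\<^sup>2" using \<open>e > 0\<close> by (simp add: field_simps)
    have "continuous_on ({0..T} \<times> {-R..R}) (\<lambda>p. z (fst p) (snd p))"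
      using continuous_on_subset[OF cont, of "{0..T} \<times> {-R..R}"] by (auto simp: case_prod_unfold)
    then have "continuous_on ({0..T} \<times> {-R..R}) (\<lambda>p. P (fst p) (snd p))"
      unfolding P_def by (intro continuous_intros)
    moreover have "compact ({0..T} \<times> {-R..R})" by (intro compact_Times compact_Icc)
    moreover have "{0..T} \<times> {-R..R} \<noteq> {}" using t R by auto
    ultimately obtain p where p: "p \<in> {0..T} \<times> {-R..R}"
      "\<forall>q \<in> {0..T} \<times> {-R..R}. P (fst q) (snd q) \<le> P (fst p) (snd p)"
      using continuous_attains_sup[of "{0..T} \<times> {-R..R}" "\<lambda>p. P (fst p) (snd p)"] by blast
    define s y where "s = fst p" and "y = snd p"
    have s: "s \<in> {0..T}" and y: "\<bar>y\<bar> \<le> R" using p(1) unfolding s_def y_def by force+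
    have max: "P s' y' \<le> P s y" if "s' \<in> {0..T}" "\<bar>y'\<bar> \<le> R" for s' y'
    proof -
      have "- R \<le> y'" "y' \<le> R" using that(2) by linarith+
      then show ?thesis using p(2)[rule_format, of "(s', y')"] that(1) by (auto simp: s_def y_def)
    qed
    have "P t x > 0" using pos by (simp add: P_def)
    then have Ppos: "P s y > 0" using max[of t x] t R by auto
    \<comment> \<open>Positivity of the maximum excludes the initial line, where \<open>z\<close> is
      at most 0, and then the lateral sides, where the penalty exceeds \<open>B\<close>.\<close>
    have "e * (y\<^sup>2 + 3 * s) \<ge> 0" using \<open>e > 0\<close> s by auto
    then have zpos: "z s y > 0" using Ppos by (simp add: P_def)
    have "s \<noteq> 0" using zpos init[of y] by auto
    then have s': "s \<in> {0<..T}" using s by auto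
    have "e * y\<^sup>2 \<le> e * (y\<^sup>2 + 3 * s)" using \<open>e > 0\<close> s by simp
    then have "e * y\<^sup>2 < e * R\<^sup>2" using Ppos bdd[OF s, of y] eR by (simp add: P_def)
    then have "\<bar>y\<bar>\<^sup>2 < R\<^sup>2" using \<open>e > 0\<close> by simp
    then have "\<bar>y\<bar> < R" using R(1) by (intro power2_less_imp_less[of _ R]) auto
    have "((\<lambda>s. P s y) has_real_derivative zt s y - 3 * e) (at s)"
      unfolding P_def by (auto intro!: derivative_eq_intros zt s')
    \<comment> \<open>The two derivative tests give \<open>zt s y \<ge> 3 * e\<close> and
      \<open>zxx s y \<le> 2 * e\<close>. The coefficient 3 of time in the penalty was chosen to
      exceed 2, the second derivative of the square, so this contradicts \<open>sub\<close>.\<close>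
    then have "zt s y - 3 * e \<ge> 0"
      by (rule left_max_deriv_nonneg[where a = 0]) (use s s' y in \<open>auto intro: max\<close>)
    moreover have "zxx s y - 2 * e \<le> 0"
    proof (rule local_max_second_deriv_nonpos[where f = "P s" and r = "R - \<bar>y\<bar>"])
      show "(P s has_real_derivative zx s w - 2 * e * w) (at w)" for w
        unfolding P_def by (auto intro!: derivative_eq_intros zx s')
      show "((\<lambda>w. zx s w - 2 * e * w) has_real_derivative zxx s y - 2 * e) (at y)"
        by (auto intro!: derivative_eq_intros zxx s')
    qed (use s \<open>\<bar>y\<bar> < R\<close> in \<open>auto intro: max\<close>)
    ultimately show False using sub[OF s' zpos] \<open>e > 0\<close> by linarith
  qed
  show ?thesis
  proof (rule ccontr)
    assume "\<not> z t x \<le> 0"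
    define c where "c = x\<^sup>2 + 3 * t"
    have "c \<ge> 0" using t by (simp add: c_def)
    \<comment> \<open>This choice of \<open>e\<close> replaces the limit \<open>e\<close> to 0: the
      penalty at the given point is then less than half of \<open>z t x\<close>. The added 1 covers
      \<open>c = 0\<close>.\<close>
    then have "z t x / (2 * (c + 1)) * c < z t x"
      using \<open>\<not> z t x \<le> 0\<close> by (simp add: field_simps add_strict_increasing2)
    moreover have "z t x \<le> z t x / (2 * (c + 1)) * c"
      unfolding c_def by (rule penalised) (use \<open>\<not> z t x \<le> 0\<close> \<open>c \<ge> 0\<close> in \<open>simp add: c_def\<close>)
    ultimately show False by simp
  qed
qed

section \<open>One-sided Lipschitz bound for the logarithmic nonlinearity\<close>

lemma log_nonlinearity_odd: "log_nonlinearity lam (- z) = - log_nonlinearity lam z"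
  by (simp add: log_nonlinearity_def)

lemma log_nonlinearity_pos:
  assumes "z > 0" shows "log_nonlinearity lam z = 2 * lam * (z * ln z)"
  using assms by (simp add: log_nonlinearity_def ln_realpow)

text \<open>For positive arguments the slope is \<open>2 * lam * (1 + ln z)\<close>, bounded above
  by its value at \<open>M\<close>. At \<open>b = 0\<close>, where it is unbounded below, the
  extension by 0 leaves only \<open>ln a \<le> 1 + ln M\<close> to check.\<close>

lemma log_nonlinearity_one_sided_Lipschitz_nonneg:
  assumes "lam > 0" "M \<ge> 1" "0 \<le> b" "b < a" "a \<le> M"
  shows "log_nonlinearity lam a - log_nonlinearity lam b \<le> 2 * lam * (1 + ln M) * (a - b)"
proof -
  have lnM: "ln a \<le> ln M" using assms by simp
  have "log_nonlinearity lam a - log_nonlinearity lam b \<le> 2 * lam * ((1 + ln M) * (a - b))"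
  proof (cases "b = 0")
    case True
    have "ln a \<le> 1 + ln M" using lnM by simp
    then have "a * ln a \<le> a * (1 + ln M)" using assms by (intro mult_left_mono) auto
    then have "2 * lam * (a * ln a) \<le> 2 * lam * (a * (1 + ln M))"
      by (rule mult_left_mono) (use assms(1) in simp)
    then show ?thesis using True assms
      by (simp add: log_nonlinearity_pos) (simp add: log_nonlinearity_def mult.commute)
  next
    case False
    then have "b > 0" "a > 0" using assms by auto
    \<comment> \<open>The difference \<open>a * ln a - b * ln b\<close> is split as
      \<open>(a - b) * ln a + b * (ln a - ln b)\<close>; the second summand is at most
      \<open>a - b\<close>.\<close>
    have "b * (ln a - ln b) \<le> b * (a / b - 1)"
      using ln_le_minus_one[of "a / b"] \<open>b > 0\<close> \<open>a > 0\<close> by (intro mult_left_mono) (auto simp: ln_div)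
    moreover have "b * (a / b - 1) = a - b" using \<open>b > 0\<close> by (simp add: field_simps)
    moreover have "(a - b) * ln a \<le> (a - b) * ln M" using assms lnM by (intro mult_left_mono) auto
    ultimately have "a * ln a - b * ln b \<le> (1 + ln M) * (a - b)" by (simp add: algebra_simps)
    then have "2 * lam * (a * ln a - b * ln b) \<le> 2 * lam * ((1 + ln M) * (a - b))"
      using assms(1) by (intro mult_left_mono) auto
    then show ?thesis using \<open>b > 0\<close> \<open>a > 0\<close>
      by (simp add: log_nonlinearity_pos right_diff_distrib)
  qed
  then show ?thesis by (simp add: mult.assoc)
qed

lemma log_nonlinearity_one_sided_Lipschitz:
  assumes "lam > 0" "M \<ge> 1" "b < a" "\<bar>a\<bar> \<le> M" "\<bar>b\<bar> \<le> M"
  shows "log_nonlinearity lam a - log_nonlinearity lam b \<le> 2 * lam * (1 + ln M) * (a - b)"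
proof -
  note nonneg = log_nonlinearity_one_sided_Lipschitz_nonneg[OF assms(1,2)]
  \<comment> \<open>Oddness reduces the case of two nonpositive arguments to the nonnegative one.
    For opposite signs the interval is cut at 0 and the bounds for the two pieces are added.\<close>
  consider "b \<ge> 0" | "a \<le> 0" | "b < 0" "a > 0" by linarith
  then show ?thesis
  proof cases
    case 1 then show ?thesis using assms by (intro nonneg) auto
  next
    case 2 then show ?thesis using nonneg[of "- a" "- b"] assms by (simp add: log_nonlinearity_odd)
  next
    case 3
    then show ?thesis using nonneg[of 0 a] nonneg[of 0 "- b"] assms
      by (simp add: log_nonlinearity_odd algebra_simps) (simp add: log_nonlinearity_def)
  qed
qed

section \<open>Comparison of two solutions\<close>

text \<open>The hypotheses are symmetric in \<open>u\<close> and \<open>v\<close>, so one inequality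
  already yields uniqueness.\<close>

lemma log_heat_solution_le:
  assumes "lam > 0" and u: "log_heat_solution lam u0 u" and v: "log_heat_solution lam u0 v"
    and "t \<ge> 0"
  shows "u t x \<le> v t x"
proof -
  \<comment> \<open>Adding 1 keeps the horizon positive even for \<open>t = 0\<close>.\<close>
  define T where "T = t + 1"
  have T: "T > 0" "t \<in> {0..T}" using \<open>t \<ge> 0\<close> by (auto simp: T_def)
  note U = u[unfolded log_heat_solution_def, THEN conjunct2, THEN conjunct1, rule_format, OF T(1)]
  note V = v[unfolded log_heat_solution_def, THEN conjunct2, THEN conjunct1, rule_format, OF T(1)]
  have u_init: "u 0 x = u0 x" and v_init: "v 0 x = u0 x" for x
    using u v unfolding log_heat_solution_def by blast+
  obtain ut ux uxx where
    ud: "\<And>t x. t \<in> {0<..T} \<Longrightarrow> ((\<lambda>s. u s x) has_real_derivative ut t x) (at t)"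
      "\<And>t x. t \<in> {0<..T} \<Longrightarrow> ((\<lambda>y. u t y) has_real_derivative ux t x) (at x)"
      "\<And>t x. t \<in> {0<..T} \<Longrightarrow> ((\<lambda>y. ux t y) has_real_derivative uxx t x) (at x)"
    and u_eq: "\<And>t x. t \<in> {0<..T} \<Longrightarrow> ut t x = uxx t x + log_nonlinearity lam (u t x)"
    using U by blast
  obtain vt vx vxx where
    vd: "\<And>t x. t \<in> {0<..T} \<Longrightarrow> ((\<lambda>s. v s x) has_real_derivative vt t x) (at t)"
      "\<And>t x. t \<in> {0<..T} \<Longrightarrow> ((\<lambda>y. v t y) has_real_derivative vx t x) (at x)"
      "\<And>t x. t \<in> {0<..T} \<Longrightarrow> ((\<lambda>y. vx t y) has_real_derivative vxx t x) (at x)"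
    and v_eq: "\<And>t x. t \<in> {0<..T} \<Longrightarrow> vt t x = vxx t x + log_nonlinearity lam (v t x)"
    using V by blast
  obtain B where B: "\<And>t x. t \<in> {0..T} \<Longrightarrow> \<bar>u t x\<bar> \<le> B"
    using U unfolding bounded_iff by fastforce
  obtain C where C: "\<And>t x. t \<in> {0..T} \<Longrightarrow> \<bar>v t x\<bar> \<le> C"
    using V unfolding bounded_iff by fastforce
  \<comment> \<open>The lower bound 1 makes \<open>ln M\<close>, hence \<open>L\<close>,
    nonnegative, so the weight \<open>exp (- L * t)\<close> is at most 1 and \<open>z\<close>
    inherits the bound \<open>2 * M\<close>.\<close>
  define M where "M = max 1 (max B C)"
  have M: "M \<ge> 1" "\<And>t x. t \<in> {0..T} \<Longrightarrow> \<bar>u t x\<bar> \<le> M" "\<And>t x. t \<in> {0..T} \<Longrightarrow> \<bar>v t x\<bar> \<le> M"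
    using B C unfolding M_def by (auto simp: le_max_iff_disj)
  define L where "L = 2 * lam * (1 + ln M)"
  have "L \<ge> 0" using \<open>lam > 0\<close> M(1) by (simp add: L_def)
  define z where "z = (\<lambda>t x. exp (- L * t) * (u t x - v t x))"
  have "z t x \<le> 0"
  proof (rule heat_maximum_principle[where z = z and T = T and B = "2 * M"
      and zt = "\<lambda>t x. exp (- L * t) * (ut t x - vt t x - L * (u t x - v t x))"
      and zx = "\<lambda>t x. exp (- L * t) * (ux t x - vx t x)"
      and zxx = "\<lambda>t x. exp (- L * t) * (uxx t x - vxx t x)"])
    show "continuous_on ({0..T} \<times> UNIV) (\<lambda>(t, x). z t x)"
      using U[THEN conjunct1] V[THEN conjunct1] unfolding z_def case_prod_unfold
      by (auto intro!: continuous_intros)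
    show "z t x \<le> 2 * M" if "t \<in> {0..T}" for t x
    proof -
      have "z t x \<le> exp (- L * t) * (2 * M)"
        unfolding z_def using M(2)[OF that, of x] M(3)[OF that, of x] by (intro mult_left_mono) auto
      also have "\<dots> \<le> 1 * (2 * M)"
        using that \<open>L \<ge> 0\<close> M(1) by (intro mult_right_mono) auto
      finally show ?thesis by simp
    qed
    \<comment> \<open>Differentiating the weight produces \<open>- L * (u t x - v t x)\<close>,
      which absorbs the difference of the nonlinearities where \<open>u\<close> exceeds
      \<open>v\<close>.\<close>
    show "exp (- L * t) * (ut t x - vt t x - L * (u t x - v t x))
        \<le> exp (- L * t) * (uxx t x - vxx t x)" if s: "t \<in> {0<..T}" and "z t x > 0" for t x
    proof -
      have "u t x > v t x" using \<open>z t x > 0\<close> by (simp add: z_def zero_less_mult_iff)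
      then have "log_nonlinearity lam (u t x) - log_nonlinearity lam (v t x) \<le> L * (u t x - v t x)"
        unfolding L_def using s
        by (intro log_nonlinearity_one_sided_Lipschitz \<open>lam > 0\<close> M) auto
      then show ?thesis using u_eq[OF s] v_eq[OF s] by (intro mult_left_mono) auto
    qed
    fix t x assume "t \<in> {0<..T}"
    note d = ud[OF this] vd[OF this]
    show "((\<lambda>s. z s x) has_real_derivative
        exp (- L * t) * (ut t x - vt t x - L * (u t x - v t x))) (at t)"
      unfolding z_def by (rule derivative_eq_intros refl d | simp add: algebra_simps)+
    show "((\<lambda>y. z t y) has_real_derivative exp (- L * t) * (ux t x - vx t x)) (at x)"
      unfolding z_def by (rule derivative_eq_intros refl d | simp)+
    show "((\<lambda>y. exp (- L * t) * (ux t y - vx t y)) has_real_derivative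
        exp (- L * t) * (uxx t x - vxx t x)) (at x)"
      by (rule derivative_eq_intros refl d | simp)+
  qed (use T(2) in \<open>auto simp: z_def u_init v_init\<close>)
  then show ?thesis by (simp add: z_def mult_le_0_iff)
qed

section \<open>The Gaussian solution\<close>

lemma gaussian_deriv:
  fixes b a x :: real
  shows "((\<lambda>x. b * exp (- (a / 2) * x\<^sup>2)) has_real_derivative - a * x * (b * exp (- (a / 2) * x\<^sup>2))) (at x)"
    and "((\<lambda>x. - a * x * (b * exp (- (a / 2) * x\<^sup>2))) has_real_derivative
      (a\<^sup>2 * x\<^sup>2 - a) * (b * exp (- (a / 2) * x\<^sup>2))) (at x)"
  by (auto intro!: derivative_eq_intros simp: algebra_simps power2_eq_square)

text \<open>Used to bound the polynomial factors in the derivatives of a Gaussian. The quadratic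
  case is \<open>1 + s \<le> exp s\<close> at \<open>s = c * x\<^sup>2\<close>; the linear one
  follows from \<open>\<bar>x\<bar> \<le> 1 + x\<^sup>2\<close>.\<close>

lemma gaussian_moments_bounded:
  fixes c x :: real
  assumes "c > 0"
  shows "x\<^sup>2 * exp (- c * x\<^sup>2) \<le> 1 / c" and "\<bar>x\<bar> * exp (- c * x\<^sup>2) \<le> 1 + 1 / c"
proof -
  have "c * x\<^sup>2 \<le> exp (c * x\<^sup>2)" using exp_ge_add_one_self[of "c * x\<^sup>2"] by linarith
  then show 1: "x\<^sup>2 * exp (- c * x\<^sup>2) \<le> 1 / c"
    using assms by (simp add: exp_minus field_simps)
  have "0 \<le> (\<bar>x\<bar> - 1)\<^sup>2" by simp
  then have "\<bar>x\<bar> \<le> 1 + x\<^sup>2" by (simp add: power2_diff)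
  then have "\<bar>x\<bar> * exp (- c * x\<^sup>2) \<le> (1 + x\<^sup>2) * exp (- c * x\<^sup>2)" by (intro mult_right_mono) auto
  also have "\<dots> = exp (- c * x\<^sup>2) + x\<^sup>2 * exp (- c * x\<^sup>2)" by (simp add: algebra_simps)
  also have "\<dots> \<le> 1 + 1 / c" using assms 1 by (intro add_mono) auto
  finally show "\<bar>x\<bar> * exp (- c * x\<^sup>2) \<le> 1 + 1 / c" .
qed

lemma admissible_gaussian:
  fixes a b :: real
  assumes "a > 0" "b > 0"
  shows "admissible_datum (\<lambda>x. b * exp (- (a / 2) * x\<^sup>2))"
proof -
  define g where "g = (\<lambda>x. b * exp (- (a / 2) * x\<^sup>2))"
  define g1 where "g1 = (\<lambda>x. - a * x * g x)"
  define g2 where "g2 = (\<lambda>x. (a\<^sup>2 * x\<^sup>2 - a) * g x)"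
  have d: "(g has_real_derivative g1 x) (at x)" "(g1 has_real_derivative g2 x) (at x)" for x
    unfolding g_def g1_def g2_def by (rule gaussian_deriv)+
  have cont: "continuous_on UNIV g" "continuous_on UNIV g1" "continuous_on UNIV g2"
    unfolding g_def g1_def g2_def by (auto intro!: continuous_intros)
  have g: "0 < g x" "g x \<le> b" for x using assms by (auto simp: g_def mult_le_cancel_left1)
  have "\<bar>g1 x\<bar> \<le> a * b * (1 + 1 / (a / 2))" for x
  proof -
    have "\<bar>g1 x\<bar> = a * b * (\<bar>x\<bar> * exp (- (a / 2) * x\<^sup>2))"
      using assms by (simp add: g1_def g_def abs_mult)
    also have "\<dots> \<le> a * b * (1 + 1 / (a / 2))"
      using assms by (intro mult_left_mono gaussian_moments_bounded) auto
    finally show ?thesis .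
  qed
  then have b1: "bounded (range g1)" unfolding bounded_iff by auto
  have "\<bar>g2 x\<bar> \<le> a\<^sup>2 * b * (1 / (a / 2)) + a * b" for x
  proof -
    have "\<bar>g2 x\<bar> \<le> a\<^sup>2 * x\<^sup>2 * g x + a * g x"
      using assms g(1)[of x] unfolding g2_def left_diff_distrib
      by (intro order.trans[OF abs_triangle_ineq4]) auto
    also have "a\<^sup>2 * x\<^sup>2 * g x = a\<^sup>2 * b * (x\<^sup>2 * exp (- (a / 2) * x\<^sup>2))" by (simp add: g_def)
    also have "\<dots> \<le> a\<^sup>2 * b * (1 / (a / 2))"
      using assms by (intro mult_left_mono gaussian_moments_bounded) auto
    also have "a * g x \<le> a * b" using assms g by simp
    finally show ?thesis by simp
  qed
  then have b2: "bounded (g2 ` UNIV)" unfolding bounded_iff by auto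
  have b0: "bounded (range g)" unfolding bounded_iff using g by (auto intro!: exI[of _ b] simp: less_imp_le)
  \<comment> \<open>The datum is smooth, so the exceptional set is empty.\<close>
  show ?thesis unfolding admissible_datum_def g_def[symmetric]
    by (intro conjI exI[of _ g1] exI[of _ g2] exI[of _ "{}"]) (use d cont b0 b1 b2 in auto)
qed

section \<open>Differential equations for width and amplitude\<close>

text \<open>Although \<open>lam - a0\<close> may be negative,
  \<open>exp (2 * lam * t) \<ge> 1\<close> keeps the first expression at least \<open>lam\<close>.
  The second, the argument of the logarithm in \<open>psi\<close>, is the first times
  \<open>exp (- 2 * lam * t)\<close>.\<close>

lemma width_denominator_pos:
  fixes lam a0 t :: real
  assumes "lam > 0" "a0 > 0" "t \<ge> 0"
  shows "lam - a0 + a0 * exp (2 * lam * t) > 0" and "a0 + (lam - a0) * exp (- 2 * lam * t) > 0"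
proof -
  have "exp (2 * lam * t) \<ge> 1" using assms by simp
  then have "a0 * 1 \<le> a0 * exp (2 * lam * t)" using assms by (intro mult_left_mono) auto
  then show pos: "lam - a0 + a0 * exp (2 * lam * t) > 0" using assms(1) by linarith
  have "a0 + (lam - a0) * exp (- 2 * lam * t)
      = (lam - a0 + a0 * exp (2 * lam * t)) * exp (- 2 * lam * t)"
    by (simp add: algebra_simps flip: exp_add)
  then show "a0 + (lam - a0) * exp (- 2 * lam * t) > 0" using pos by simp
qed

lemma inverse_width_pos:
  assumes "lam > 0" "a0 > 0" "t \<ge> 0"
  shows "inverse_width lam a0 t > 0"
  using width_denominator_pos(1)[OF assms] assms by (simp add: inverse_width_def)

text \<open>This logistic equation comes from matching the coefficients of \<open>x\<^sup>2\<close>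
  in the Gaussian ansatz.\<close>

lemma inverse_width_deriv:
  assumes "lam > 0" "a0 > 0" "t \<ge> 0"
  shows "(inverse_width lam a0 has_real_derivative
    2 * lam * inverse_width lam a0 t - 2 * (inverse_width lam a0 t)\<^sup>2) (at t)"
proof -
  define N where "N = (\<lambda>t. a0 * exp (2 * lam * t))"
  define D where "D = (\<lambda>t. lam - a0 + N t)"
  have "D t \<noteq> 0" using width_denominator_pos(1)[OF assms] by (simp add: D_def N_def)
  have N': "(N has_real_derivative 2 * lam * N t) (at t)"
    unfolding N_def by (auto intro!: derivative_eq_intros)
  then have D': "(D has_real_derivative 2 * lam * N t) (at t)"
    unfolding D_def by (auto intro!: derivative_eq_intros)
  \<comment> \<open>Numerator and denominator have the same derivative, so the quotient rule gives
    \<open>2 * lam\<^sup>2 * (N t / D t - (N t / D t)\<^sup>2)\<close>.\<close>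
  have w: "inverse_width lam a0 = (\<lambda>t. lam * (N t / D t))"
    by (simp add: fun_eq_iff inverse_width_def N_def D_def)
  show ?thesis
    unfolding w using \<open>D t \<noteq> 0\<close>
    by (auto intro!: derivative_eq_intros N' D') (simp add: field_simps power2_eq_square)
qed

text \<open>Matching the terms free of \<open>x\<close> gives \<open>B' = 2 * lam * B - a\<close>
  for the logarithm \<open>B\<close> of the amplitude; the integrating factor
  \<open>exp (- 2 * lam * t)\<close> turns it into this equation for \<open>psi\<close>.\<close>

lemma psi_deriv:
  assumes "lam > 0" "a0 > 0" "t \<ge> 0"
  shows "(psi lam b0 a0 has_real_derivative - inverse_width lam a0 t * exp (- 2 * lam * t)) (at t)"
proof -
  define E where "E = exp (2 * lam * t)"
  have E: "E > 0" "exp (- 2 * lam * t) = 1 / E" by (simp_all add: E_def exp_minus field_simps)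
  have pos: "lam - a0 + a0 * E > 0" "a0 + (lam - a0) / E > 0"
    using width_denominator_pos[OF assms] E by (simp_all add: E_def)
  show ?thesis
  proof (cases "a0 = lam")
    case True
    \<comment> \<open>The value \<open>lam\<close> is the equilibrium of the logistic
      equation.\<close>
    have "inverse_width lam a0 t = lam" using True assms by (simp add: inverse_width_def)
    then show ?thesis unfolding psi_def using True
      by (auto intro!: derivative_eq_intros)
  next
    case False
    define c where "c = lam - a0"
    have c: "c \<noteq> 0" using False by (simp add: c_def)
    define f where "f = (\<lambda>t. a0 + c * exp (- 2 * lam * t))"
    have f: "f t = a0 + c / E" "f t > 0" using pos E by (simp_all add: f_def c_def)
    have f': "(f has_real_derivative - 2 * lam * (c / E)) (at t)"
      unfolding f_def using E(2) by (auto intro!: derivative_eq_intros)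
    have psi: "psi lam b0 a0 = (\<lambda>t. ln b0 - a0 / 2 * ((ln lam - ln (f t)) / c))"
      using False by (simp add: fun_eq_iff psi_def f_def c_def)
    have "(psi lam b0 a0 has_real_derivative - (a0 * lam / (E * f t))) (at t)"
      unfolding psi using f(2) c by (auto intro!: derivative_eq_intros f' simp: mult.commute)
    \<comment> \<open>The factor \<open>c\<close> has cancelled in the derivative of
      \<open>psi\<close>, and \<open>E * f t\<close> is exactly the denominator of
      \<open>inverse_width\<close>.\<close>
    moreover have "E * f t = lam - a0 + a0 * E" using E(1) f(1) by (simp add: c_def field_simps)
    moreover have "inverse_width lam a0 t * (1 / E) = a0 * lam / (lam - a0 + a0 * E)"
      using E(1) by (simp add: inverse_width_def flip: E_def)
    ultimately show ?thesis unfolding E(2) by simp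
  qed
qed

section \<open>Verification that the Gaussian is a solution\<close>

text \<open>The logarithm of the Gaussian is quadratic in \<open>x\<close>, so after factoring out
  the function itself the equation compares two quadratic polynomials, whose coefficients agree by
  the equations for width and amplitude.\<close>

lemma log_heat_solution_gaussian:
  assumes "lam > 0" "b0 > 0" "a0 > 0"
  shows "log_heat_solution lam (\<lambda>x. b0 * exp (- (a0 / 2) * x\<^sup>2))
    (\<lambda>t x. amplitude lam b0 a0 t * exp (- (inverse_width lam a0 t / 2) * x\<^sup>2))"
proof -
  define a where "a = inverse_width lam a0"
  define B where "B = (\<lambda>t. psi lam b0 a0 t * exp (2 * lam * t))"
  define v where "v = (\<lambda>t x. exp (B t) * exp (- (a t / 2) * x\<^sup>2))"
  have v: "(\<lambda>t x. amplitude lam b0 a0 t * exp (- (inverse_width lam a0 t / 2) * x\<^sup>2)) = v"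
    by (simp add: v_def B_def a_def amplitude_def)
  have a': "(a has_real_derivative 2 * lam * a t - 2 * (a t)\<^sup>2) (at t)" if "t \<ge> 0" for t
    unfolding a_def using inverse_width_deriv assms that by blast
  have B': "(B has_real_derivative 2 * lam * B t - a t) (at t)" if "t \<ge> 0" for t
    unfolding B_def a_def
    by (auto intro!: derivative_eq_intros psi_deriv assms that)
      (simp add: algebra_simps flip: exp_add)
  have a_pos: "a t > 0" if "t \<ge> 0" for t using inverse_width_pos assms that by (simp add: a_def)
  have ca: "continuous_on {0..} a" and cB: "continuous_on {0..} B"
    using a' B' by (auto intro!: continuous_at_imp_continuous_on DERIV_isCont)
  have init: "v 0 x = b0 * exp (- (a0 / 2) * x\<^sup>2)" for x
    using assms by (simp add: v_def B_def a_def psi_def inverse_width_def)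
  have log_v: "log_nonlinearity lam (v t x) = 2 * lam * (B t - a t / 2 * x\<^sup>2) * v t x" for t x
  proof -
    have "v t x = exp (B t - a t / 2 * x\<^sup>2)" by (simp add: v_def flip: exp_add)
    then show ?thesis by (simp add: log_nonlinearity_pos)
  qed
  have "continuous_on ({0..T} \<times> UNIV) (\<lambda>(t, x). v t x) \<and>
        bounded ((\<lambda>(t, x). v t x) ` ({0..T} \<times> UNIV)) \<and>
        (\<exists>ut ux uxx.
           (\<forall>t\<in>{0<..T}. \<forall>x.
              ((\<lambda>s. v s x) has_real_derivative ut t x) (at t) \<and>
              ((\<lambda>y. v t y) has_real_derivative ux t x) (at x) \<and>
              ((\<lambda>y. ux t y) has_real_derivative uxx t x) (at x)) \<and>
           continuous_on ({0<..T} \<times> UNIV) (\<lambda>(t, x). ut t x) \<and>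
           continuous_on ({0<..T} \<times> UNIV) (\<lambda>(t, x). ux t x) \<and>
           continuous_on ({0<..T} \<times> UNIV) (\<lambda>(t, x). uxx t x) \<and>
           (\<forall>t\<in>{0<..T}. \<forall>x. ut t x = uxx t x + log_nonlinearity lam (v t x))) \<and>
        (\<exists>M R. \<forall>t\<in>{0..T}. \<forall>x. \<bar>x\<bar> \<ge> R \<longrightarrow> \<bar>v t x\<bar> \<le> M)" if "T > 0" for T
  proof -
    \<comment> \<open>Here the equations for \<open>a\<close> and \<open>B\<close> are already
      inserted into the factor \<open>B' - a' / 2 * x\<^sup>2\<close>.\<close>
    define vt where "vt = (\<lambda>t x. (2 * lam * B t - a t - (lam * a t - (a t)\<^sup>2) * x\<^sup>2) * v t x)"
    define vx where "vx = (\<lambda>t x. - a t * x * v t x)"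
    define vxx where "vxx = (\<lambda>t x. ((a t)\<^sup>2 * x\<^sup>2 - a t) * v t x)"
    have cfst: "continuous_on ({0..T} \<times> UNIV) (\<lambda>p :: real \<times> real. h (fst p))"
      if "continuous_on {0..} h" for h :: "real \<Rightarrow> real"
      by (rule continuous_on_compose2[OF that]) (auto intro!: continuous_intros)
    have cont: "continuous_on ({0..T} \<times> UNIV) (\<lambda>(t, x). v t x)"
      "continuous_on ({0..T} \<times> UNIV) (\<lambda>(t, x). vt t x)"
      "continuous_on ({0..T} \<times> UNIV) (\<lambda>(t, x). vx t x)"
      "continuous_on ({0..T} \<times> UNIV) (\<lambda>(t, x). vxx t x)"
      unfolding vt_def vx_def vxx_def v_def case_prod_unfold
      by (auto intro!: continuous_intros cfst ca cB)
    have sub: "({0<..T} \<times> UNIV :: (real \<times> real) set) \<subseteq> {0..T} \<times> UNIV" by auto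
    \<comment> \<open>The amplitude is continuous, hence bounded, on the compact time interval, and
      positivity of \<open>a\<close> keeps the spatial factor at most 1. The resulting
      \<open>M\<close> serves both for the global bound and for large
      \<open>\<bar>x\<bar>\<close>.\<close>
    have "compact ((\<lambda>t. exp (B t)) ` {0..T})"
      using cB by (intro compact_continuous_image continuous_intros)
        (auto intro: continuous_on_subset)
    then have "\<exists>M. \<forall>t\<in>{0..T}. exp (B t) \<le> M"
      using compact_imp_bounded[of "(\<lambda>t. exp (B t)) ` {0..T}"] unfolding bounded_iff by auto
    then obtain M where M: "\<And>t. t \<in> {0..T} \<Longrightarrow> exp (B t) \<le> M" by blast
    have v_le: "\<bar>v t x\<bar> \<le> M" if "t \<in> {0..T}" for t x
    proof -
      have "exp (- (a t / 2) * x\<^sup>2) \<le> 1" using a_pos[of t] that by simp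
      then have "\<bar>v t x\<bar> \<le> exp (B t) * 1"
        unfolding v_def abs_mult by (intro mult_mono) auto
      then show ?thesis using M[OF that] by simp
    qed
    have dt: "((\<lambda>s. v s x) has_real_derivative vt t x) (at t)" if "t \<in> {0<..T}" for t x
    proof -
      have "t \<ge> 0" using that by simp
      note d = a'[OF this] B'[OF this]
      show ?thesis unfolding v_def vt_def
        by (auto intro!: derivative_eq_intros d) (simp add: field_simps)
    qed
    have "((\<lambda>y. v t y) has_real_derivative vx t x) (at x)"
      "((\<lambda>y. vx t y) has_real_derivative vxx t x) (at x)" for t x
      unfolding v_def vx_def vxx_def by (rule gaussian_deriv)+
    moreover have "vt t x = vxx t x + log_nonlinearity lam (v t x)" for t x
      unfolding log_v vt_def vxx_def by (simp add: algebra_simps)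
    moreover have "bounded ((\<lambda>(t, x). v t x) ` ({0..T} \<times> UNIV))"
      unfolding bounded_iff using v_le by (intro exI[of _ M]) auto
    ultimately show ?thesis
      using dt v_le cont cont[THEN continuous_on_subset, OF sub]
      by (intro conjI exI[of _ vt] exI[of _ vx] exI[of _ vxx] exI[of _ M]) auto
  qed
  then show ?thesis
    unfolding v log_heat_solution_def using init admissible_gaussian assms by auto
qed

theorem proposition4p1:
  fixes lam b0 a0 :: real and u0 :: "real \<Rightarrow> real" and v :: "real \<Rightarrow> real \<Rightarrow> real"
  assumes "lam > 0" and "b0 > 0" and "a0 > 0"
    and "u0 = (\<lambda>x. b0 * exp (- (a0 / 2) * x\<^sup>2))"
    and "v = (\<lambda>t x. amplitude lam b0 a0 t * exp (- (inverse_width lam a0 t / 2) * x\<^sup>2))"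
  shows "log_heat_solution lam u0 v \<and>
    (\<forall>u. log_heat_solution lam u0 u \<longrightarrow> (\<forall>t\<ge>0. \<forall>x. u t x = v t x))"
proof -
  have "log_heat_solution lam u0 v"
    unfolding assms(4,5) using assms(1-3) by (rule log_heat_solution_gaussian)
  \<comment> \<open>Comparison in both orders between the Gaussian and any other solution gives
    equality.\<close>
  then show ?thesis
    using log_heat_solution_le[OF \<open>lam > 0\<close>] by (blast intro: antisym)
qed

end
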